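(* Let $A\in\mathbb{R}^{m\times n}$ be a matrix without zero rows, with rows $\mathbf a_1^\top,\dots,\mathbf a_m^\top$ (so $\mathbf a_i=A^\top\mathbf e_i\in\mathbb{R}^n$). Let $L_1\in\mathbb{R}^{m\times m}$ be the lower triangular part of $AA^\top$, including the diagonal, and let $G=I-A^\top L_1^{-1}A\in\mathbb{R}^{n\times n}$. Then $0$ is an eigenvalue of $G$ with corresponding (right) eigenvector $\mathbf a_1=A^\top\mathbf e_1$, i.e. $G\,\mathbf a_1=\mathbf 0$, and with corresponding left eigenvector $\mathbf a_m=A^\top\mathbf e_m$, i.e. $\mathbf a_m^\top G=\mathbf 0^\top$.
   Context: $\mathbf e_i$ denotes the $i$th standard unit vector of $\mathbb{R}^m$. Since $A$ has no zero rows, the diagonal of $AA^\top$ is positive, so $L_1$ is nonsingular. $G$ is the iteration matrix of one sweep of the Kaczmarz method $\mathbf x_{k+1}=\mathbf x_k+A^\top L_1^{-1}(\mathbf b-A\mathbf x_k)$ with relaxation parameter $\omega=1$. *)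

theory Defs
  imports "Jordan_Normal_Form.Char_Poly" "Jordan_Normal_Form.Gauss_Jordan_Elimination"
begin

definition lower_part :: "'a :: zero mat \<Rightarrow> 'a mat" where
  "lower_part M = mat (dim_row M) (dim_col M) (\<lambda>(i, j). if j \<le> i then M $$ (i, j) else 0)"

definition kaczmarz_L :: "real mat \<Rightarrow> real mat" where
  "kaczmarz_L A = lower_part (A * A\<^sup>T)"

(* mat_inverse is option-valued. Applying "the" is justified by kaczmarz_L_inverse below:
   the inverse exists whenever A has no zero rows. *)
definition kaczmarz_G :: "real mat \<Rightarrow> real mat" where
  "kaczmarz_G A = 1\<^sub>m (dim_col A) - A\<^sup>T * the (mat_inverse (kaczmarz_L A)) * A"

(* The row-vector counterpart of eigenvector: v^T M = k v^T with v nonzero. *)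
definition left_eigenvector :: "'a :: comm_ring_1 mat \<Rightarrow> 'a vec \<Rightarrow> 'a \<Rightarrow> bool" where
  "left_eigenvector M v k \<longleftrightarrow>
     v \<in> carrier_vec (dim_row M) \<and> v \<noteq> 0\<^sub>v (dim_row M) \<and>
     mat_of_row v * M = k \<cdot>\<^sub>m mat_of_row v"

lemma kaczmarz_L_carrier:
  assumes "A \<in> carrier_mat m n"
  shows "kaczmarz_L A \<in> carrier_mat m m"
  using assms by (simp add: kaczmarz_L_def lower_part_def)

lemma kaczmarz_G_carrier:
  assumes "A \<in> carrier_mat m n"
  shows "kaczmarz_G A \<in> carrier_mat n n"
  using assms by (auto simp: kaczmarz_G_def)

lemma kaczmarz_L_inverse:
  assumes A: "A \<in> carrier_mat m n"
    and nz: "\<And>i. i < m \<Longrightarrow> row A i \<noteq> 0\<^sub>v n"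
  shows "kaczmarz_L A * the (mat_inverse (kaczmarz_L A)) = 1\<^sub>m m"
    and "the (mat_inverse (kaczmarz_L A)) * kaczmarz_L A = 1\<^sub>m m"
    and "the (mat_inverse (kaczmarz_L A)) \<in> carrier_mat m m"
proof -
  let ?L = "kaczmarz_L A"
  have L: "?L \<in> carrier_mat m m"
    using A by (rule kaczmarz_L_carrier)
  have diag: "?L $$ (i, i) \<noteq> 0" if i: "i < m" for i
  proof -
    have r: "row A i \<in> carrier_vec n"
      using A by auto
    have "?L $$ (i, i) = row A i \<bullet> row A i"
      using A i by (simp add: kaczmarz_L_def lower_part_def)
    then show ?thesis
      using nz[OF i] conjugate_square_eq_0_vec[OF r] by (simp add: conjugate_real_def)
  qed
  have "det ?L = prod_list (diag_mat ?L)"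
    by (rule det_lower_triangular[OF _ L]) (use A in \<open>simp add: kaczmarz_L_def lower_part_def\<close>)
  then have "det ?L \<noteq> 0"
    using diag L by (auto simp: diag_mat_def prod_list_zero_iff)
  then have "?L \<in> Units (ring_mat TYPE(real) m ())"
    by (rule det_non_zero_imp_unit[OF L])
  then obtain B where "mat_inverse ?L = Some B"
    using mat_inverse(1)[OF L, where b = "()"] by (cases "mat_inverse ?L") auto
  then show "?L * the (mat_inverse ?L) = 1\<^sub>m m"
    and "the (mat_inverse ?L) * ?L = 1\<^sub>m m"
    and "the (mat_inverse ?L) \<in> carrier_mat m m"
    using mat_inverse(2)[OF L] by auto
qed

end

theory Submission
  imports Defs
begin

text \<open>The first column of \<open>A * A\<^sup>T\<close> and its last row lie entirely in the lower triangle, so they agree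
  with those of \<open>L = kaczmarz_L A\<close>. Hence \<open>A a\<^sub>1 = L e\<^sub>1\<close> and \<open>a\<^sub>m\<^sup>T A\<^sup>T = e\<^sub>m\<^sup>T L\<close>, and the inverse
  of \<open>L\<close> cancels in \<open>G a\<^sub>1\<close> and in \<open>a\<^sub>m\<^sup>T G\<close>.\<close>

lemma mult_unit_vec_eq_col:
  fixes B :: "'a :: semiring_1 mat"
  assumes "B \<in> carrier_mat k m" and "i < m"
  shows "B *\<^sub>v unit_vec m i = col B i"
  using assms by (intro eq_vecI) auto

lemma mat_of_row_unit_vec_mult:
  fixes B :: "'a :: semiring_1 mat"
  assumes "B \<in> carrier_mat m k" and "i < m"
  shows "mat_of_row (unit_vec m i) * B = mat_of_row (row B i)"
  using assms by (intro eq_matI) auto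

lemma col_0_lower_part: "0 < dim_col M \<Longrightarrow> col (lower_part M) 0 = col M 0"
  by (intro eq_vecI) (auto simp: lower_part_def)

text \<open>Squareness makes \<open>m - 1\<close> also the largest column index, so the condition
  \<open>j \<le> i\<close> holds along the whole row. With \<open>0 < m\<close> the truncated
  subtraction really yields the last index.\<close>

lemma row_last_lower_part:
  assumes "M \<in> carrier_mat m m" and "0 < m"
  shows "row (lower_part M) (m - 1) = row M (m - 1)"
  using assms by (intro eq_vecI) (auto simp: lower_part_def)

text \<open>Here the left-inverse law \<open>K * L = 1\<^sub>m m\<close> does the work: the
  correction term of \<open>G\<close> maps \<open>row A 0\<close> to itself, so \<open>G\<close>
  maps it to zero.\<close>

lemma kaczmarz_G_mult_first_row:
  assumes A: "A \<in> carrier_mat m n" and m: "0 < m"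
    and nz: "\<And>i. i < m \<Longrightarrow> row A i \<noteq> 0\<^sub>v n"
  shows "kaczmarz_G A *\<^sub>v row A 0 = 0\<^sub>v n"
proof -
  define L where "L = kaczmarz_L A"
  define K where "K = the (mat_inverse L)"
  have KL: "K * L = 1\<^sub>m m" and K: "K \<in> carrier_mat m m"
    using kaczmarz_L_inverse[OF A nz] by (simp_all add: K_def L_def)
  have L: "L \<in> carrier_mat m m"
    using kaczmarz_L_carrier[OF A] by (simp add: L_def)
  have At: "A\<^sup>T \<in> carrier_mat n m" and a: "row A 0 \<in> carrier_vec n"
    using A by auto
  have e: "unit_vec m 0 \<in> carrier_vec m"
    by simp
  have a_eq: "A\<^sup>T *\<^sub>v unit_vec m 0 = row A 0"
    using mult_unit_vec_eq_col[OF At m] A m by simp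
  \<comment> \<open>Writing the row as \<open>A\<^sup>T\<close> times a unit vector brings in the
    Gram matrix, whose first column \<open>L\<close> shares.\<close>
  have "A *\<^sub>v row A 0 = (A * A\<^sup>T) *\<^sub>v unit_vec m 0"
    using assoc_mult_mat_vec[OF A At e] a_eq by simp
  also have "\<dots> = col (A * A\<^sup>T) 0"
    by (rule mult_unit_vec_eq_col) (use A m in auto)
  also have "\<dots> = L *\<^sub>v unit_vec m 0"
    using mult_unit_vec_eq_col[OF L m] col_0_lower_part[of "A * A\<^sup>T"] A m
    by (simp add: L_def kaczmarz_L_def)
  finally have Aa: "A *\<^sub>v row A 0 = L *\<^sub>v unit_vec m 0" .
  have "(A\<^sup>T * K * A) *\<^sub>v row A 0 = A\<^sup>T *\<^sub>v (K *\<^sub>v (L *\<^sub>v unit_vec m 0))"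
    using assoc_mult_mat_vec[OF mult_carrier_mat[OF At K] A a]
      assoc_mult_mat_vec[OF At K mult_mat_vec_carrier[OF A a]] Aa by simp
  also have "\<dots> = row A 0"
    using assoc_mult_mat_vec[OF K L e] KL a_eq by simp
  finally have "(A\<^sup>T * K * A) *\<^sub>v row A 0 = row A 0" .
  moreover have "kaczmarz_G A = 1\<^sub>m n - A\<^sup>T * K * A"
    using A by (simp add: kaczmarz_G_def K_def L_def)
  moreover have "A\<^sup>T * K * A \<in> carrier_mat n n"
    using At K A by auto
  ultimately show ?thesis
    using a minus_mult_distrib_mat_vec[OF one_carrier_mat, of "A\<^sup>T * K * A" n "row A 0"] by simp
qed

text \<open>The dual argument, now with the right-inverse law \<open>L * K = 1\<^sub>m m\<close>.
  Row vectors are encoded as matrices with one row, so that associativity of the matrix product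
  applies throughout.\<close>

lemma last_row_mult_kaczmarz_G:
  assumes A: "A \<in> carrier_mat m n" and m: "0 < m"
    and nz: "\<And>i. i < m \<Longrightarrow> row A i \<noteq> 0\<^sub>v n"
  shows "mat_of_row (row A (m - 1)) * kaczmarz_G A = 0\<^sub>m 1 n"
proof -
  define L where "L = kaczmarz_L A"
  define K where "K = the (mat_inverse L)"
  define E :: "real mat" where "E = mat_of_row (unit_vec m (m - 1))"
  define R where "R = mat_of_row (row A (m - 1))"
  have LK: "L * K = 1\<^sub>m m" and K: "K \<in> carrier_mat m m"
    using kaczmarz_L_inverse[OF A nz] by (simp_all add: K_def L_def)
  have L: "L \<in> carrier_mat m m"
    using kaczmarz_L_carrier[OF A] by (simp add: L_def)
  have At: "A\<^sup>T \<in> carrier_mat n m" and R: "R \<in> carrier_mat 1 n"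
    using A by (auto simp: R_def)
  have E: "E \<in> carrier_mat 1 m"
    by (simp add: E_def)
  have last: "m - 1 < m"
    using m by simp
  have AAt: "A * A\<^sup>T \<in> carrier_mat m m"
    using A At by simp
  have EA: "E * A = R"
    unfolding E_def R_def by (rule mat_of_row_unit_vec_mult[OF A last])
  have "R * A\<^sup>T = E * (A * A\<^sup>T)"
    using assoc_mult_mat[OF E A At] EA by simp
  \<comment> \<open>Left multiplication by \<open>E\<close> only sees the last row, where
    \<open>L\<close> and the Gram matrix coincide.\<close>
  also have "\<dots> = E * L"
    unfolding E_def mat_of_row_unit_vec_mult[OF AAt last] mat_of_row_unit_vec_mult[OF L last]
    using row_last_lower_part[OF AAt m] by (simp add: L_def kaczmarz_L_def)
  finally have RAt: "R * A\<^sup>T = E * L" .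
  \<comment> \<open>Bracketing to the left isolates \<open>R * A\<^sup>T\<close>, which
    \<open>RAt\<close> replaces by \<open>E * L\<close>; then \<open>L * K\<close> cancels and
    \<open>E * A\<close> is \<open>R\<close> again.\<close>
  have "R * (A\<^sup>T * K * A) = R * A\<^sup>T * K * A"
    using assoc_mult_mat[OF R mult_carrier_mat[OF At K] A] assoc_mult_mat[OF R At K] by simp
  also have "\<dots> = R"
    using assoc_mult_mat[OF E L K] RAt LK EA E by simp
  finally have "R * (A\<^sup>T * K * A) = R" .
  moreover have "kaczmarz_G A = 1\<^sub>m n - A\<^sup>T * K * A"
    using A by (simp add: kaczmarz_G_def K_def L_def)
  moreover have "A\<^sup>T * K * A \<in> carrier_mat n n"
    using At K A by auto
  ultimately have "R * kaczmarz_G A = R - R"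
    using mult_minus_distrib_mat[OF R one_carrier_mat] R by simp
  then show ?thesis
    using R by (simp add: R_def)
qed

theorem proposition3:
  fixes A :: "real mat" and m n :: nat
  assumes "A \<in> carrier_mat m n"
    and "0 < m"
    and "\<And>i. i < m \<Longrightarrow> row A i \<noteq> 0\<^sub>v n"
  shows "eigenvalue (kaczmarz_G A) 0
    \<and> row A 0 = A\<^sup>T *\<^sub>v unit_vec m 0
    \<and> eigenvector (kaczmarz_G A) (row A 0) 0
    \<and> kaczmarz_G A *\<^sub>v row A 0 = 0\<^sub>v n
    \<and> row A (m - 1) = A\<^sup>T *\<^sub>v unit_vec m (m - 1)
    \<and> left_eigenvector (kaczmarz_G A) (row A (m - 1)) 0
    \<and> mat_of_row (row A (m - 1)) * kaczmarz_G A = 0\<^sub>m 1 n"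
proof -
  note A = assms(1) and m = assms(2) and nz = assms(3)
  have last: "m - 1 < m"
    using m by simp
  have At: "A\<^sup>T \<in> carrier_mat n m"
    using A by simp
  have rows: "row A i \<in> carrier_vec n" for i
    using A by auto
  have row_eq: "row A i = A\<^sup>T *\<^sub>v unit_vec m i" if "i < m" for i
    using mult_unit_vec_eq_col[OF At that] A that by simp
  note right = kaczmarz_G_mult_first_row[OF A m nz]
  note left = last_row_mult_kaczmarz_G[OF A m nz]
  have dim: "dim_row (kaczmarz_G A) = n"
    using kaczmarz_G_carrier[OF A] by simp
  \<comment> \<open>The eigenvector equation has a scalar multiple on its right-hand side, so the
    zero vector is first put into that form. That the eigenvector is nonzero comes from
    \<open>nz\<close>.\<close>
  have "0 \<cdot>\<^sub>v row A 0 = 0\<^sub>v n"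
    using rows[of 0] A m by (intro eq_vecI) auto
  then have ev: "eigenvector (kaczmarz_G A) (row A 0) 0"
    using right rows[of 0] nz[OF m] by (simp add: eigenvector_def dim)
  have "0 \<cdot>\<^sub>m mat_of_row (row A (m - 1)) = 0\<^sub>m 1 n"
    using A by (intro eq_matI) auto
  then have lev: "left_eigenvector (kaczmarz_G A) (row A (m - 1)) 0"
    using left rows[of "m - 1"] nz[OF last] by (simp add: left_eigenvector_def dim)
  from ev have "eigenvalue (kaczmarz_G A) 0"
    by (auto simp: eigenvalue_def)
  with ev lev right left row_eq[OF m] row_eq[OF last] show ?thesis
    by blast
qed

end
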